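(* Each of the parameters $\mathrm{GMN}'$, $\mathrm{SMN}$, $\mathrm{SMN}'$, $\mathrm{AMN}$, $\mathrm{AMN}'$ is sub-additive but not additive.
   Context: Let $X$ be a finite set. A concept class $C$ over the domain $X=\mathrm{dom}(C)$ is a nonempty family of functions $c:X\to\{0,1\}$ (called concepts). A labeled sample of size $m\ge 0$ is a set $S=\{(x_1,b_1),\ldots,(x_m,b_m)\}\subseteq X\times\{0,1\}$ with $x_1,\ldots,x_m$ distinct; $|S|=m$ (the empty sample is allowed). A concept $c$ is consistent with $S$ if $c(x_i)=b_i$ for all $i$. $S$ is $C$-realizable if some $c\in C$ is consistent with $S$. A $C$-saturating matching is a map $M$ assigning to each $c\in C$ a labeled sample $M(c)$ with which $c$ is consistent, such that $M(c)\ne M(c')$ whenever $c\neq c'$ in $C$. Its cost is $\max_{c\in C}|M(c)|$. It has the antichain property if $M(c)\not\subseteq M(c')$ for all distinct $c,c'\in C$. Parameters: - $\mathrm{SMN}(C)$: the smallest cost of a $C$-saturating matching. - $\mathrm{SMN}'(C)$: the smallest $d$ such that the number of $C$-realizable samples of size at most $d$ is at least $|C|$. - $\mathrm{AMN}(C)$: the smallest cost of a $C$-saturating matching having the antichain property. - $\mathrm{AMN}'(C)$: the smallest $d$ such that the set of $C$-realizable samples of size at most $d$ contains an antichain (with respect to inclusion) of size $|C|$. - $\mathrm{GMN}'(C)$: the smallest $d$ such that $\sum_{i=0}^{d}\binom{|X|}{i}\ge|C|$. If $C_1,C_2$ are concept classes over disjoint domains $X_1,X_2$, their free combination is the concept class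 $C_1\sqcup C_2=\{c_1\cup c_2:c_1\in C_1,\ c_2\in C_2\}$ over $X_1\cup X_2$, where $c_1\cup c_2$ is the function that agrees with $c_i$ on $X_i$. A parameter $Y$ is sub-additive if $Y(C_1\sqcup C_2)\le Y(C_1)+Y(C_2)$ for each free combination of two concept classes, and additive if equality holds for each free combination of two concept classes. *)

theory Defs
  imports Main
begin

text \<open>
  A function \<open>X \<rightarrow> {0,1}\<close> is a partial map into \<^typ>\<open>bool\<close> whose domain is exactly \<open>X\<close>.
  The domain is passed explicitly alongside the class: \<open>X\<close> is a subset of an arbitrary type of
  points, so that the disjoint domains \<open>X\<^sub>1\<close>, \<open>X\<^sub>2\<close> of a free combination and their union live
  in the same type.
\<close>

type_synonym 'a concept = "'a \<rightharpoonup> bool"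
type_synonym 'a sample = "('a \<times> bool) set"
type_synonym 'a parameter = "'a set \<Rightarrow> 'a concept set \<Rightarrow> nat"

definition concept_class :: "'a set \<Rightarrow> 'a concept set \<Rightarrow> bool" where
  "concept_class X C \<longleftrightarrow> finite X \<and> C \<noteq> {} \<and> (\<forall>c\<in>C. dom c = X)"

text \<open>Injectivity of \<^const>\<open>fst\<close> says that the points of the sample are distinct, so that the size
  of a sample is its cardinality.\<close>

definition labeled_sample :: "'a set \<Rightarrow> 'a sample \<Rightarrow> bool" where
  "labeled_sample X S \<longleftrightarrow> S \<subseteq> X \<times> UNIV \<and> inj_on fst S"

definition consistent :: "'a concept \<Rightarrow> 'a sample \<Rightarrow> bool" where
  "consistent c S \<longleftrightarrow> (\<forall>(x, b)\<in>S. c x = Some b)"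

definition realizable :: "'a concept set \<Rightarrow> 'a sample \<Rightarrow> bool" where
  "realizable C S \<longleftrightarrow> (\<exists>c\<in>C. consistent c S)"

definition realizable_upto :: "'a set \<Rightarrow> 'a concept set \<Rightarrow> nat \<Rightarrow> 'a sample set" where
  "realizable_upto X C d = {S. labeled_sample X S \<and> realizable C S \<and> card S \<le> d}"

definition saturating_matching ::
    "'a set \<Rightarrow> 'a concept set \<Rightarrow> ('a concept \<Rightarrow> 'a sample) \<Rightarrow> bool" where
  "saturating_matching X C M \<longleftrightarrow>
     (\<forall>c\<in>C. labeled_sample X (M c) \<and> consistent c (M c)) \<and> inj_on M C"

definition cost :: "'a concept set \<Rightarrow> ('a concept \<Rightarrow> 'a sample) \<Rightarrow> nat" where
  "cost C M = Max ((\<lambda>c. card (M c)) ` C)"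

definition antichain_property :: "'a concept set \<Rightarrow> ('a concept \<Rightarrow> 'a sample) \<Rightarrow> bool" where
  "antichain_property C M \<longleftrightarrow> (\<forall>c\<in>C. \<forall>c'\<in>C. c \<noteq> c' \<longrightarrow> \<not> M c \<subseteq> M c')"

definition antichain :: "'b set set \<Rightarrow> bool" where
  "antichain A \<longleftrightarrow> (\<forall>S\<in>A. \<forall>T\<in>A. S \<noteq> T \<longrightarrow> \<not> S \<subseteq> T)"

definition SMN :: "'a parameter" where
  "SMN X C = (LEAST d. \<exists>M. saturating_matching X C M \<and> cost C M = d)"

definition SMN' :: "'a parameter" where
  "SMN' X C = (LEAST d. card (realizable_upto X C d) \<ge> card C)"

definition AMN :: "'a parameter" where
  "AMN X C = (LEAST d. \<exists>M. saturating_matching X C M \<and> antichain_property C M \<and> cost C M = d)"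

definition AMN' :: "'a parameter" where
  "AMN' X C = (LEAST d. \<exists>A. A \<subseteq> realizable_upto X C d \<and> antichain A \<and> card A = card C)"

definition GMN' :: "'a parameter" where
  "GMN' X C = (LEAST d. (\<Sum>i=0..d. card X choose i) \<ge> card C)"

definition free_combination :: "'a concept set \<Rightarrow> 'a concept set \<Rightarrow> 'a concept set" where
  "free_combination C1 C2 = {c1 ++ c2 | c1 c2. c1 \<in> C1 \<and> c2 \<in> C2}"

definition sub_additive :: "'a parameter \<Rightarrow> bool" where
  "sub_additive Y \<longleftrightarrow>
     (\<forall>X1 C1 X2 C2. concept_class X1 C1 \<and> concept_class X2 C2 \<and> X1 \<inter> X2 = {} \<longrightarrow>
        Y (X1 \<union> X2) (free_combination C1 C2) \<le> Y X1 C1 + Y X2 C2)"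

definition additive :: "'a parameter \<Rightarrow> bool" where
  "additive Y \<longleftrightarrow>
     (\<forall>X1 C1 X2 C2. concept_class X1 C1 \<and> concept_class X2 C2 \<and> X1 \<inter> X2 = {} \<longrightarrow>
        Y (X1 \<union> X2) (free_combination C1 C2) = Y X1 C1 + Y X2 C2)"

lemma concept_class_free_combination:
  assumes "concept_class X1 C1" "concept_class X2 C2"
  shows "concept_class (X1 \<union> X2) (free_combination C1 C2)"
  unfolding concept_class_def
proof (intro conjI ballI)
  show "finite (X1 \<union> X2)" "free_combination C1 C2 \<noteq> {}"
    using assms by (auto simp: concept_class_def free_combination_def)
next
  fix c assume "c \<in> free_combination C1 C2"
  then obtain c1 c2 where "c = c1 ++ c2" "c1 \<in> C1" "c2 \<in> C2"
    unfolding free_combination_def by blast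
  then show "dom c = X1 \<union> X2"
    using assms by (simp add: concept_class_def Un_commute)
qed

end

theory Submission
  imports Defs
begin

text \<open>
  Sub-additivity: samples over disjoint domains are joined by union, and the two parts of a union
  can be recovered from it, so joining preserves distinctness, realizability and antichains, while
  sizes add up. Non-additivity: a class consisting of the two constant concepts needs samples
  of size 1, since only one sample has size 0. In the free combination of two such classes, over
  \<open>X\<^sub>1 \<ni> x\<close> and \<open>X\<^sub>2 \<ni> y\<close>, samples of size 1 still suffice: if the two constants agree, show
  the label of \<open>x\<close>, otherwise show the label of \<open>y\<close>. The four resulting samples are
  the four labeled points over \<open>{x, y}\<close>.
\<close>

section \<open>Unions over disjoint domains\<close>

text \<open>If the members of \<open>A\<close> and of \<open>B\<close> lie in two disjoint sets,
  this is a copy of the product of \<open>A\<close> and \<open>B\<close>, with inclusion read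
  componentwise. The element type is left open because labeled samples are joined and, for
  \<open>GMN'\<close>, also plain subsets of the domains.\<close>

definition join :: "'b set set \<Rightarrow> 'b set set \<Rightarrow> 'b set set" where
  "join A B = (\<lambda>(S, T). S \<union> T) ` (A \<times> B)"

text \<open>Intersecting a union with \<open>Y1\<close> and with \<open>Y2\<close> gives back its
  two parts.\<close>

lemma disjoint_Un_subset_iff:
  assumes "S \<subseteq> Y1" "S' \<subseteq> Y1" "T \<subseteq> Y2" "T' \<subseteq> Y2" "Y1 \<inter> Y2 = {}"
  shows "S \<union> T \<subseteq> S' \<union> T' \<longleftrightarrow> S \<subseteq> S' \<and> T \<subseteq> T'"
  using assms by blast

lemma disjoint_Un_eq_iff:
  assumes "S \<subseteq> Y1" "S' \<subseteq> Y1" "T \<subseteq> Y2" "T' \<subseteq> Y2" "Y1 \<inter> Y2 = {}"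
  shows "S \<union> T = S' \<union> T' \<longleftrightarrow> S = S' \<and> T = T'"
  using assms by blast

lemma card_join:
  assumes "\<And>S. S \<in> A \<Longrightarrow> S \<subseteq> Y1" "\<And>T. T \<in> B \<Longrightarrow> T \<subseteq> Y2" "Y1 \<inter> Y2 = {}"
  shows "card (join A B) = card A * card B"
proof -
  have "inj_on (\<lambda>(S, T). S \<union> T) (A \<times> B)"
    unfolding inj_on_def using disjoint_Un_eq_iff[OF assms(1,1,2,2,3)] by auto
  then show ?thesis
    by (simp add: join_def card_image card_cartesian_product)
qed

text \<open>Distinct unions differ in at least one part, and for that part the antichain assumption
  excludes inclusion.\<close>

lemma antichain_join:
  assumes "\<And>S. S \<in> A \<Longrightarrow> S \<subseteq> Y1" "\<And>T. T \<in> B \<Longrightarrow> T \<subseteq> Y2" "Y1 \<inter> Y2 = {}"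
    and "antichain A" "antichain B"
  shows "antichain (join A B)"
  unfolding antichain_def
proof (intro ballI impI)
  fix U V assume "U \<in> join A B" "V \<in> join A B" and ne: "U \<noteq> V"
  then obtain S T S' T' where *: "S \<in> A" "T \<in> B" "S' \<in> A" "T' \<in> B" "U = S \<union> T" "V = S' \<union> T'"
    by (auto simp: join_def)
  with ne assms(4,5) show "\<not> U \<subseteq> V"
    using disjoint_Un_subset_iff[OF assms(1,1,2,2,3), of S S' T T']
    unfolding antichain_def by blast
qed

section \<open>Free combinations of concepts and of realizable samples\<close>

lemma finite_concept_class:
  assumes "concept_class X C"
  shows "finite C"
proof (rule finite_subset)
  show "C \<subseteq> {c. dom c = X \<and> ran c \<subseteq> UNIV}"
    using assms by (auto simp: concept_class_def)
  show "finite {c :: 'a concept. dom c = X \<and> ran c \<subseteq> UNIV}"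
    using assms by (intro finite_set_of_finite_maps) (auto simp: concept_class_def)
qed

lemma map_add_restrict_disjoint:
  assumes "dom c1 = X1" "dom c2 = X2" "X1 \<inter> X2 = {}"
  shows "(c1 ++ c2) |` X1 = c1" "(c1 ++ c2) |` X2 = c2"
  using assms by (auto simp: fun_eq_iff restrict_map_def map_add_def split: option.splits)

lemma card_free_combination:
  assumes "concept_class X1 C1" "concept_class X2 C2" "X1 \<inter> X2 = {}"
  shows "card (free_combination C1 C2) = card C1 * card C2"
proof -
  have "inj_on (\<lambda>(c1, c2). c1 ++ c2) (C1 \<times> C2)"
  \<comment> \<open>Restricting to the two domains undoes \<open>++\<close>.\<close>
  proof (rule inj_on_inverseI[where g = "\<lambda>c. (c |` X1, c |` X2)"])
    show "\<And>p. p \<in> C1 \<times> C2 \<Longrightarrow>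
      ((case p of (c1, c2) \<Rightarrow> c1 ++ c2) |` X1, (case p of (c1, c2) \<Rightarrow> c1 ++ c2) |` X2) = p"
      using assms map_add_restrict_disjoint by (fastforce simp: concept_class_def)
  qed
  moreover have "free_combination C1 C2 = (\<lambda>(c1, c2). c1 ++ c2) ` (C1 \<times> C2)"
    by (auto simp: free_combination_def)
  ultimately show ?thesis
    by (simp add: card_image card_cartesian_product)
qed

lemma labeled_sample_Un:
  assumes "labeled_sample X1 S" "labeled_sample X2 T" "X1 \<inter> X2 = {}"
  shows "labeled_sample (X1 \<union> X2) (S \<union> T)"
  using assms unfolding labeled_sample_def by (fastforce simp: inj_on_Un)

lemma consistent_map_add:
  assumes "consistent c1 S" "consistent c2 T" "dom c1 \<inter> dom c2 = {}"
  shows "consistent (c1 ++ c2) (S \<union> T)"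
proof -
  \<comment> \<open>\<open>++\<close> lets the right map win; since the domains are disjoint, the
    two maps commute and the values of \<open>c1\<close> survive as well.\<close>
  have "c1 ++ c2 = c2 ++ c1"
    using assms(3) by (rule map_add_comm)
  then have "c1 x = Some b \<Longrightarrow> (c1 ++ c2) x = Some b" for x b
    by (metis map_add_find_right)
  with assms show ?thesis
    by (auto simp: consistent_def)
qed

lemma finite_realizable_upto:
  assumes "concept_class X C"
  shows "finite (realizable_upto X C d)"
  by (rule finite_subset[of _ "Pow (X \<times> UNIV)"])
    (use assms in \<open>auto simp: realizable_upto_def labeled_sample_def concept_class_def\<close>)

lemma realizable_upto_subset: "S \<in> realizable_upto X C d \<Longrightarrow> S \<subseteq> X \<times> UNIV"
  by (simp add: realizable_upto_def labeled_sample_def)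

text \<open>If \<open>c1\<close> realizes one part and \<open>c2\<close> the other, then
  \<open>c1 ++ c2\<close> realizes the union.\<close>

lemma join_realizable_upto:
  assumes "concept_class X1 C1" "concept_class X2 C2" "X1 \<inter> X2 = {}"
  shows "join (realizable_upto X1 C1 d1) (realizable_upto X2 C2 d2)
    \<subseteq> realizable_upto (X1 \<union> X2) (free_combination C1 C2) (d1 + d2)"
proof
  fix U assume "U \<in> join (realizable_upto X1 C1 d1) (realizable_upto X2 C2 d2)"
  then obtain S T c1 c2 where U: "U = S \<union> T"
    and S: "labeled_sample X1 S" "c1 \<in> C1" "consistent c1 S" "card S \<le> d1"
    and T: "labeled_sample X2 T" "c2 \<in> C2" "consistent c2 T" "card T \<le> d2"
    by (auto simp: join_def realizable_upto_def realizable_def)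
  have "dom c1 \<inter> dom c2 = {}"
    using assms S T by (simp add: concept_class_def)
  then have "consistent (c1 ++ c2) U"
    using S T U by (simp add: consistent_map_add)
  moreover have "c1 ++ c2 \<in> free_combination C1 C2"
    using S T by (auto simp: free_combination_def)
  moreover have "labeled_sample (X1 \<union> X2) U"
    using S T U assms(3) by (simp add: labeled_sample_Un)
  moreover have "card U \<le> d1 + d2"
    using card_Un_le[of S T] S T U by simp
  ultimately show "U \<in> realizable_upto (X1 \<union> X2) (free_combination C1 C2) (d1 + d2)"
    by (auto simp: realizable_upto_def realizable_def)
qed

section \<open>Attainment and comparison of the parameters\<close>

text \<open>The link from matchings to \<open>SMN'\<close> and \<open>AMN'\<close>: a matching of
  cost d (with the antichain property in the case of \<open>AMN'\<close>) supplies the family of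
  samples that these parameters ask for at d.\<close>

lemma saturating_matching_image:
  assumes "concept_class X C" "saturating_matching X C M"
  shows "M ` C \<subseteq> realizable_upto X C (cost C M)" "card (M ` C) = card C"
proof -
  have "card (M c) \<le> cost C M" if "c \<in> C" for c
    using that finite_concept_class[OF assms(1)] by (simp add: cost_def)
  then show "M ` C \<subseteq> realizable_upto X C (cost C M)" "card (M ` C) = card C"
    using assms(2)
    by (auto simp: saturating_matching_def realizable_upto_def realizable_def card_image)
qed

text \<open>Revealing a whole concept always works, since distinct functions with the same domain
  have incomparable graphs. Hence every \<open>LEAST\<close> over matchings or realizable samples
  ranges over a nonempty set, and the minima are attained.\<close>

lemma graph_antichain_matching:
  assumes "concept_class X C"
  shows "saturating_matching X C Map.graph" "antichain_property C Map.graph"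
proof -
  have eq: "c = c'" if "c \<in> C" "c' \<in> C" "Map.graph c \<subseteq> Map.graph c'" for c c'
  proof -
    have "c \<subseteq>\<^sub>m c'"
      using that(3) by (auto simp: map_le_def Map.graph_def)
    then show ?thesis
      using that(1,2) assms by (metis concept_class_def map_le_antisym map_le_def)
  qed
  then show "antichain_property C Map.graph"
    by (auto simp: antichain_property_def)
  show "saturating_matching X C Map.graph"
    unfolding saturating_matching_def
  proof (intro conjI ballI)
    fix c assume "c \<in> C"
    then show "labeled_sample X (Map.graph c)"
      using assms by (auto simp: labeled_sample_def Map.graph_def concept_class_def inj_on_def)
    show "consistent c (Map.graph c)"
      by (auto simp: consistent_def Map.graph_def)
  qed (auto intro: inj_onI eq)
qed

section \<open>Minimality and attainment for the matching and sample parameters\<close>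

lemma SMN_attained:
  assumes "concept_class X C"
  obtains M where "saturating_matching X C M" "cost C M = SMN X C"
  using LeastI_ex[of "\<lambda>d. \<exists>M. saturating_matching X C M \<and> cost C M = d"]
    graph_antichain_matching[OF assms] unfolding SMN_def by blast

lemma SMN_le: "saturating_matching X C M \<Longrightarrow> SMN X C \<le> cost C M"
  unfolding SMN_def by (rule Least_le) blast

lemma AMN_attained:
  assumes "concept_class X C"
  obtains M where "saturating_matching X C M" "antichain_property C M" "cost C M = AMN X C"
  using LeastI_ex[of "\<lambda>d. \<exists>M. saturating_matching X C M \<and> antichain_property C M \<and> cost C M = d"]
    graph_antichain_matching[OF assms] unfolding AMN_def by blast

lemma AMN_le:
  "saturating_matching X C M \<Longrightarrow> antichain_property C M \<Longrightarrow> AMN X C \<le> cost C M"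
  unfolding AMN_def by (rule Least_le) blast

lemma antichain_image:
  "antichain_property C M \<Longrightarrow> antichain (M ` C)"
  by (auto simp: antichain_property_def antichain_def)

lemma AMN'_le:
  "A \<subseteq> realizable_upto X C d \<Longrightarrow> antichain A \<Longrightarrow> card A = card C \<Longrightarrow> AMN' X C \<le> d"
  unfolding AMN'_def by (rule Least_le) blast

lemma AMN'_attained:
  assumes "concept_class X C"
  obtains A where "A \<subseteq> realizable_upto X C (AMN' X C)" "antichain A" "card A = card C"
proof -
  note M = graph_antichain_matching[OF assms]
  \<comment> \<open>The graphs of the concepts form such an antichain, with their cost as
    \<open>d\<close>.\<close>
  have "\<exists>d A. A \<subseteq> realizable_upto X C d \<and> antichain A \<and> card A = card C"
    using saturating_matching_image[OF assms M(1)] antichain_image[OF M(2)] by (intro exI conjI)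
  from LeastI_ex[OF this] show thesis
    using that unfolding AMN'_def by blast
qed

lemma SMN'_le: "card C \<le> card (realizable_upto X C d) \<Longrightarrow> SMN' X C \<le> d"
  unfolding SMN'_def by (rule Least_le)

lemma SMN'_attained:
  assumes "concept_class X C"
  shows "card C \<le> card (realizable_upto X C (SMN' X C))"
proof -
  have "\<exists>d. card C \<le> card (realizable_upto X C d)"
    using graph_antichain_matching(1)[OF assms] saturating_matching_image[OF assms]
      card_mono[OF finite_realizable_upto[OF assms]] by metis
  then show ?thesis
    unfolding SMN'_def by (rule LeastI_ex)
qed

text \<open>This and the next three comparisons place \<open>SMN'\<close> at the bottom and
  \<open>AMN\<close> at the top, with \<open>SMN\<close> and \<open>AMN'\<close> in between. For the
  counterexample it then suffices to bound \<open>SMN'\<close> from below and \<open>AMN\<close>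
  from above, apart from \<open>GMN'\<close>.\<close>

lemma SMN_le_AMN:
  assumes "concept_class X C"
  shows "SMN X C \<le> AMN X C"
  by (rule AMN_attained[OF assms]) (metis SMN_le)

lemma SMN'_le_SMN:
  assumes "concept_class X C"
  shows "SMN' X C \<le> SMN X C"
proof (rule SMN_attained[OF assms])
  fix M assume M: "saturating_matching X C M" "cost C M = SMN X C"
  show ?thesis
    using saturating_matching_image[OF assms M(1)] M(2)
      card_mono[OF finite_realizable_upto[OF assms]] by (metis SMN'_le)
qed

lemma AMN'_le_AMN:
  assumes "concept_class X C"
  shows "AMN' X C \<le> AMN X C"
  by (rule AMN_attained[OF assms])
    (metis AMN'_le antichain_image saturating_matching_image[OF assms])

lemma SMN'_le_AMN':
  assumes "concept_class X C"
  shows "SMN' X C \<le> AMN' X C"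
  by (rule AMN'_attained[OF assms])
    (metis SMN'_le card_mono finite_realizable_upto[OF assms])

text \<open>Reading the binomial sum as a count of small subsets lets \<open>GMN'\<close> be treated
  by the same joining argument as \<open>SMN'\<close>.\<close>

lemma sum_choose_eq_card_subsets:
  assumes "finite X"
  shows "(\<Sum>i=0..d. card X choose i) = card {A. A \<subseteq> X \<and> card A \<le> d}"
proof -
  have "{A. A \<subseteq> X \<and> card A \<le> d} = (\<Union>i\<in>{0..d}. {A. A \<subseteq> X \<and> card A = i})"
    by auto
  also have "card \<dots> = (\<Sum>i=0..d. card {A. A \<subseteq> X \<and> card A = i})"
    using assms by (intro card_UN_disjoint) auto
  also have "\<dots> = (\<Sum>i=0..d. card X choose i)"
    by (simp add: n_subsets[OF assms])
  finally show ?thesis by simp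
qed

text \<open>A concept is determined by the points labeled \<open>True\<close>: the rest of
  \<open>X\<close> is labeled \<open>False\<close>, and outside \<open>X\<close> it is
  undefined.\<close>

lemma card_concept_class_le:
  assumes "concept_class X C"
  shows "card C \<le> 2 ^ card X"
proof -
  let ?f = "\<lambda>c :: 'a concept. {x \<in> X. c x = Some True}"
  have X: "finite X" "\<And>c. c \<in> C \<Longrightarrow> dom c = X"
    using assms by (auto simp: concept_class_def)
  have "inj_on ?f C"
  proof (intro inj_onI ext)
    fix c c' x assume c: "c \<in> C" "c' \<in> C" and eq: "?f c = ?f c'"
    have "x \<in> X \<Longrightarrow> c x = Some True \<longleftrightarrow> c' x = Some True"
      using eq by blast
    moreover have "x \<in> X \<longleftrightarrow> c x \<noteq> None" "x \<in> X \<longleftrightarrow> c' x \<noteq> None"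
      using X(2) c by blast+
    ultimately show "c x = c' x"
      by (metis (full_types) not_None_eq)
  qed
  then have "card C \<le> card (Pow X)"
    using X(1) by (intro card_inj_on_le[of ?f]) auto
  then show ?thesis
    by (simp add: card_Pow X(1))
qed

lemma GMN'_le: "card C \<le> (\<Sum>i=0..d. card X choose i) \<Longrightarrow> GMN' X C \<le> d"
  unfolding GMN'_def by (rule Least_le)

lemma GMN'_attained:
  assumes "concept_class X C"
  shows "card C \<le> (\<Sum>i=0..GMN' X C. card X choose i)"
proof -
  \<comment> \<open>At d = \<open>card X\<close> the binomial sum is the full row sum, a power of
    2.\<close>
  have "card C \<le> (\<Sum>i=0..card X. card X choose i)"
    using card_concept_class_le[OF assms] choose_row_sum[of "card X"] by (simp add: atMost_atLeast0)
  then show ?thesis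
    unfolding GMN'_def by (rule LeastI)
qed

section \<open>Sub-additivity\<close>

text \<open>The components of a combined concept are recovered by restriction, so no choice of a
  decomposition is needed.\<close>

definition join_matching ::
    "'a set \<Rightarrow> ('a concept \<Rightarrow> 'a sample) \<Rightarrow> 'a set \<Rightarrow> ('a concept \<Rightarrow> 'a sample) \<Rightarrow>
     'a concept \<Rightarrow> 'a sample"
  where "join_matching X1 M1 X2 M2 c = M1 (c |` X1) \<union> M2 (c |` X2)"

context
  fixes X1 X2 :: "'a set" and C1 C2 :: "'a concept set"
  assumes C1: "concept_class X1 C1" and C2: "concept_class X2 C2" and disj: "X1 \<inter> X2 = {}"
begin

lemma disjoint_labeled_points: "(X1 \<times> UNIV) \<inter> (X2 \<times> UNIV) = {}"
  using disj by blast

lemma free_combinationD: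
  assumes "c \<in> free_combination C1 C2"
  shows "c |` X1 \<in> C1" "c |` X2 \<in> C2" "c |` X1 ++ c |` X2 = c"
    "dom (c |` X1) \<inter> dom (c |` X2) = {}"
proof -
  obtain c1 c2 where c: "c = c1 ++ c2" "c1 \<in> C1" "c2 \<in> C2"
    using assms by (auto simp: free_combination_def)
  then have "dom c1 = X1" "dom c2 = X2"
    using C1 C2 by (simp_all add: concept_class_def)
  then have "c |` X1 = c1" "c |` X2 = c2"
    unfolding c(1) using disj by (simp_all add: map_add_restrict_disjoint)
  then show "c |` X1 \<in> C1" "c |` X2 \<in> C2" "c |` X1 ++ c |` X2 = c"
    using c by simp_all
  show "dom (c |` X1) \<inter> dom (c |` X2) = {}"
    using disj by auto
qed

text \<open>The two parts of a joined sample lie over disjoint domains, so inclusion splits. Both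
  injectivity and the antichain property of the joined matching follow from this.\<close>

lemma join_matching_subsetD:
  assumes "saturating_matching X1 C1 M1" "saturating_matching X2 C2 M2"
    and "c \<in> free_combination C1 C2" "c' \<in> free_combination C1 C2"
    and "join_matching X1 M1 X2 M2 c \<subseteq> join_matching X1 M1 X2 M2 c'"
  shows "M1 (c |` X1) \<subseteq> M1 (c' |` X1) \<and> M2 (c |` X2) \<subseteq> M2 (c' |` X2)"
proof -
  have "M1 d \<subseteq> X1 \<times> UNIV" if "d \<in> C1" for d
    using assms(1) that by (simp add: saturating_matching_def labeled_sample_def)
  moreover have "M2 d \<subseteq> X2 \<times> UNIV" if "d \<in> C2" for d
    using assms(2) that by (simp add: saturating_matching_def labeled_sample_def)
  ultimately show ?thesis
    using assms(3-5) disjoint_Un_subset_iff[OF _ _ _ _ disjoint_labeled_points]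
    unfolding join_matching_def by (metis free_combinationD)
qed

lemma saturating_join_matching:
  assumes M: "saturating_matching X1 C1 M1" "saturating_matching X2 C2 M2"
  shows "saturating_matching (X1 \<union> X2) (free_combination C1 C2) (join_matching X1 M1 X2 M2)"
  unfolding saturating_matching_def
proof (intro conjI ballI inj_onI)
  fix c assume c: "c \<in> free_combination C1 C2"
  then show "labeled_sample (X1 \<union> X2) (join_matching X1 M1 X2 M2 c)"
    using M disj unfolding saturating_matching_def join_matching_def
    by (metis free_combinationD labeled_sample_Un)
  from c show "consistent c (join_matching X1 M1 X2 M2 c)"
    using M unfolding saturating_matching_def join_matching_def
    by (metis free_combinationD consistent_map_add)
next
  fix c c' assume c: "c \<in> free_combination C1 C2" "c' \<in> free_combination C1 C2"
    and "join_matching X1 M1 X2 M2 c = join_matching X1 M1 X2 M2 c'"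
  \<comment> \<open>Equality is inclusion in both directions, and each direction splits.\<close>
  then have "M1 (c |` X1) = M1 (c' |` X1)" "M2 (c |` X2) = M2 (c' |` X2)"
    using join_matching_subsetD[OF M] by (simp_all add: subset_antisym)
  then have "c |` X1 = c' |` X1" "c |` X2 = c' |` X2"
    using M c unfolding saturating_matching_def inj_on_def by (metis free_combinationD)+
  then show "c = c'"
    using c by (metis free_combinationD)
qed

lemma antichain_join_matching:
  assumes M: "saturating_matching X1 C1 M1" "saturating_matching X2 C2 M2"
    and A: "antichain_property C1 M1" "antichain_property C2 M2"
  shows "antichain_property (free_combination C1 C2) (join_matching X1 M1 X2 M2)"
  unfolding antichain_property_def
proof (intro ballI impI notI)
  fix c c' assume c: "c \<in> free_combination C1 C2" "c' \<in> free_combination C1 C2" "c \<noteq> c'"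
    and "join_matching X1 M1 X2 M2 c \<subseteq> join_matching X1 M1 X2 M2 c'"
  then have "M1 (c |` X1) \<subseteq> M1 (c' |` X1)" "M2 (c |` X2) \<subseteq> M2 (c' |` X2)"
    using join_matching_subsetD[OF M] by auto
  \<comment> \<open>In each factor the antichain property turns inclusion of samples into equality
    of concepts.\<close>
  then have "c |` X1 = c' |` X1" "c |` X2 = c' |` X2"
    using A c unfolding antichain_property_def by (metis free_combinationD)+
  then show False
    using c by (metis free_combinationD)
qed

lemma cost_join_matching:
  "cost (free_combination C1 C2) (join_matching X1 M1 X2 M2) \<le> cost C1 M1 + cost C2 M2"
proof -
  have fc: "concept_class (X1 \<union> X2) (free_combination C1 C2)"
    using C1 C2 by (rule concept_class_free_combination)
  have "card (join_matching X1 M1 X2 M2 c) \<le> cost C1 M1 + cost C2 M2"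
    if "c \<in> free_combination C1 C2" for c
  proof -
    have "card (join_matching X1 M1 X2 M2 c) \<le> card (M1 (c |` X1)) + card (M2 (c |` X2))"
      unfolding join_matching_def by (rule card_Un_le)
    moreover have "c |` X1 \<in> C1" "c |` X2 \<in> C2"
      using that by (rule free_combinationD)+
    then have "card (M1 (c |` X1)) \<le> cost C1 M1" "card (M2 (c |` X2)) \<le> cost C2 M2"
      using C1 C2 by (simp_all add: cost_def finite_concept_class)
    ultimately show ?thesis by linarith
  qed
  then show ?thesis
    using fc finite_concept_class[OF fc]
    by (simp add: cost_def[of "free_combination C1 C2"] concept_class_def)
qed

section \<open>Sub-additivity of each of the five parameters\<close>

lemma SMN_free_combination_le: "SMN (X1 \<union> X2) (free_combination C1 C2) \<le> SMN X1 C1 + SMN X2 C2"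
  by (rule SMN_attained[OF C1], rule SMN_attained[OF C2])
    (metis SMN_le cost_join_matching le_trans saturating_join_matching)

lemma AMN_free_combination_le: "AMN (X1 \<union> X2) (free_combination C1 C2) \<le> AMN X1 C1 + AMN X2 C2"
  by (rule AMN_attained[OF C1], rule AMN_attained[OF C2])
    (metis AMN_le antichain_join_matching cost_join_matching le_trans saturating_join_matching)

text \<open>The numbers of concepts multiply, and so do the numbers of samples when optimal families
  are joined.\<close>

lemma SMN'_free_combination_le:
  "SMN' (X1 \<union> X2) (free_combination C1 C2) \<le> SMN' X1 C1 + SMN' X2 C2"
proof (rule SMN'_le)
  let ?R1 = "realizable_upto X1 C1 (SMN' X1 C1)" and ?R2 = "realizable_upto X2 C2 (SMN' X2 C2)"
  have "card (free_combination C1 C2) = card C1 * card C2"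
    using C1 C2 disj by (rule card_free_combination)
  also have "\<dots> \<le> card ?R1 * card ?R2"
    using C1 C2 by (intro mult_le_mono SMN'_attained)
  also have "\<dots> = card (join ?R1 ?R2)"
    by (intro card_join[OF _ _ disjoint_labeled_points, symmetric] realizable_upto_subset)
  also have "\<dots> \<le> card (realizable_upto (X1 \<union> X2) (free_combination C1 C2) (SMN' X1 C1 + SMN' X2 C2))"
    using C1 C2 disj
    by (intro card_mono join_realizable_upto finite_realizable_upto concept_class_free_combination)
  finally show "card (free_combination C1 C2) \<le>
      card (realizable_upto (X1 \<union> X2) (free_combination C1 C2) (SMN' X1 C1 + SMN' X2 C2))" .
qed

lemma AMN'_free_combination_le:
  "AMN' (X1 \<union> X2) (free_combination C1 C2) \<le> AMN' X1 C1 + AMN' X2 C2"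
proof (rule AMN'_attained[OF C1], rule AMN'_attained[OF C2])
  fix A B
  assume A: "A \<subseteq> realizable_upto X1 C1 (AMN' X1 C1)" "antichain A" "card A = card C1"
    and B: "B \<subseteq> realizable_upto X2 C2 (AMN' X2 C2)" "antichain B" "card B = card C2"
  have sub: "\<And>S. S \<in> A \<Longrightarrow> S \<subseteq> X1 \<times> UNIV" "\<And>T. T \<in> B \<Longrightarrow> T \<subseteq> X2 \<times> UNIV"
    using A(1) B(1) realizable_upto_subset by blast+
  show ?thesis
  proof (rule AMN'_le)
    have "join A B \<subseteq> join (realizable_upto X1 C1 (AMN' X1 C1)) (realizable_upto X2 C2 (AMN' X2 C2))"
      using A(1) B(1) unfolding join_def by (intro image_mono Sigma_mono)
    also have "\<dots> \<subseteq> realizable_upto (X1 \<union> X2) (free_combination C1 C2) (AMN' X1 C1 + AMN' X2 C2)"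
      using C1 C2 disj by (rule join_realizable_upto)
    finally show "join A B \<subseteq> \<dots>" .
    show "antichain (join A B)"
      using sub disjoint_labeled_points A(2) B(2) by (rule antichain_join)
    show "card (join A B) = card (free_combination C1 C2)"
      using card_join[OF sub disjoint_labeled_points] A(3) B(3) card_free_combination[OF C1 C2 disj]
      by simp
  qed
qed

lemma GMN'_free_combination_le:
  "GMN' (X1 \<union> X2) (free_combination C1 C2) \<le> GMN' X1 C1 + GMN' X2 C2"
proof (rule GMN'_le)
  \<comment> \<open>\<open>P X d\<close> takes the place of the family of realizable samples: small
    subsets of disjoint domains are joined.\<close>
  define P where "P X d = {A. A \<subseteq> X \<and> card A \<le> d}" for X :: "'a set" and d
  have fin: "finite X1" "finite X2"
    using C1 C2 by (simp_all add: concept_class_def)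
  have P: "(\<Sum>i=0..d. card X choose i) = card (P X d)" if "finite X" for X :: "'a set" and d
    using that unfolding P_def by (rule sum_choose_eq_card_subsets)
  have "card (free_combination C1 C2) = card C1 * card C2"
    using C1 C2 disj by (rule card_free_combination)
  also have "\<dots> \<le> card (P X1 (GMN' X1 C1)) * card (P X2 (GMN' X2 C2))"
    using GMN'_attained[OF C1] GMN'_attained[OF C2] P fin by (simp add: mult_le_mono)
  also have "\<dots> = card (join (P X1 (GMN' X1 C1)) (P X2 (GMN' X2 C2)))"
    using disj by (intro card_join[symmetric]) (auto simp: P_def)
  also have "\<dots> \<le> card (P (X1 \<union> X2) (GMN' X1 C1 + GMN' X2 C2))"
  proof (rule card_mono)
    show "finite (P (X1 \<union> X2) (GMN' X1 C1 + GMN' X2 C2))"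
      using fin by (simp add: P_def)
    show "join (P X1 (GMN' X1 C1)) (P X2 (GMN' X2 C2)) \<subseteq> P (X1 \<union> X2) (GMN' X1 C1 + GMN' X2 C2)"
      unfolding P_def join_def by (auto intro: order_trans[OF card_Un_le add_mono])
  qed
  also have "\<dots> = (\<Sum>i=0..GMN' X1 C1 + GMN' X2 C2. card (X1 \<union> X2) choose i)"
    using fin by (simp only: P finite_Un)
  finally show "card (free_combination C1 C2)
      \<le> (\<Sum>i=0..GMN' X1 C1 + GMN' X2 C2. card (X1 \<union> X2) choose i)" .
qed

end

section \<open>Failure of additivity\<close>

text \<open>The value is \<open>None\<close> off \<open>X\<close> so that the domain is exactly
  \<open>X\<close>; for empty \<open>X\<close> the two constants coincide.\<close>

definition const_concept :: "'a set \<Rightarrow> bool \<Rightarrow> 'a concept" where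
  "const_concept X b = (\<lambda>x. if x \<in> X then Some b else None)"

definition const_class :: "'a set \<Rightarrow> 'a concept set" where
  "const_class X = range (const_concept X)"

lemma concept_class_const: "finite X \<Longrightarrow> concept_class X (const_class X)"
  by (auto simp: concept_class_def const_class_def const_concept_def dom_def)

lemma card_const_class:
  assumes "X \<noteq> {}"
  shows "card (const_class X) = 2"
proof -
  have "inj (const_concept X)"
    using assms by (auto simp: inj_def const_concept_def fun_eq_iff split: if_splits)
  then show ?thesis
    by (simp add: const_class_def card_image)
qed

section \<open>Lower bounds for classes with at least two concepts\<close>

lemma one_le_SMN':
  assumes "concept_class X C" "1 < card C"
  shows "1 \<le> SMN' X C"
proof (rule ccontr)
  assume "\<not> 1 \<le> SMN' X C"
  have "S = {}" if "S \<in> realizable_upto X C (SMN' X C)" for S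
  proof -
    \<comment> \<open>Needed because \<open>card S = 0\<close> would also hold for an infinite
      \<open>S\<close>.\<close>
    have "finite S"
      using realizable_upto_subset[OF that] assms(1)
      by (auto simp: concept_class_def dest: finite_subset)
    moreover have "card S = 0"
      using that \<open>\<not> 1 \<le> SMN' X C\<close> by (simp add: realizable_upto_def)
    ultimately show ?thesis by simp
  qed
  then have "realizable_upto X C (SMN' X C) \<subseteq> {{}}"
    by blast
  then have "card (realizable_upto X C (SMN' X C)) \<le> 1"
    using card_mono[of "{{}}" "realizable_upto X C (SMN' X C)"] by simp
  with SMN'_attained[OF assms(1)] assms(2) show False by simp
qed

lemma one_le_GMN':
  assumes "concept_class X C" "1 < card C"
  shows "1 \<le> GMN' X C"
  \<comment> \<open>If \<open>GMN'\<close> were 0, the sum would be a single binomial coefficient of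
    value 1.\<close>
  using GMN'_attained[OF assms(1)] assms(2) by (cases "GMN' X C") auto

lemma AMN_const_free_combination:
  assumes "finite X1" "finite X2" "X1 \<inter> X2 = {}" and x: "x \<in> X1" and y: "y \<in> X2"
  shows "AMN (X1 \<union> X2) (free_combination (const_class X1) (const_class X2)) \<le> 1"
proof -
  let ?C = "free_combination (const_class X1) (const_class X2)"
  \<comment> \<open>The choice of the revealed point tells whether the constants agree, so the one
    revealed label determines both of them.\<close>
  define M :: "'a concept \<Rightarrow> 'a sample"
    where "M c = (if c x = c y then {(x, the (c x))} else {(y, the (c y))})" for c
  have C: "concept_class (X1 \<union> X2) ?C"
    using assms by (intro concept_class_free_combination concept_class_const)
  have neq: "x \<noteq> y"
    using assms by blast
  have obt: "\<exists>b1 b2. c = const_concept X1 b1 ++ const_concept X2 b2 \<and> c x = Some b1 \<and> c y = Some b2"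
    if "c \<in> ?C" for c
  proof -
    obtain b1 b2 where "c = const_concept X1 b1 ++ const_concept X2 b2"
      using \<open>c \<in> ?C\<close> by (auto simp: free_combination_def const_class_def)
    moreover have "c x = Some b1" "c y = Some b2"
      unfolding \<open>c = _\<close> using assms by (auto simp: const_concept_def map_add_def split: option.splits)
    ultimately show ?thesis by (intro exI conjI)
  qed
  \<comment> \<open>Stated for inclusion rather than equality, this yields injectivity and the
    antichain property at once.\<close>
  have inj: "c = c'" if c: "c \<in> ?C" "c' \<in> ?C" "M c \<subseteq> M c'" for c c'
  proof -
    obtain b1 b2 b1' b2'
      where "c = const_concept X1 b1 ++ const_concept X2 b2" "c x = Some b1" "c y = Some b2"
        and "c' = const_concept X1 b1' ++ const_concept X2 b2'" "c' x = Some b1'" "c' y = Some b2'"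
      using obt c(1,2) by metis
    moreover from this have "b1 = b1' \<and> b2 = b2'"
      using c(3) neq by (auto simp: M_def split: if_splits)
    ultimately show ?thesis by simp
  qed
  have "saturating_matching (X1 \<union> X2) ?C M"
    unfolding saturating_matching_def
  proof (intro conjI ballI)
    fix c assume "c \<in> ?C"
    from obt[OF this] show "labeled_sample (X1 \<union> X2) (M c)" "consistent c (M c)"
      using x y by (auto simp: M_def labeled_sample_def consistent_def)
  qed (auto intro!: inj_onI inj)
  moreover have "antichain_property ?C M"
    using inj by (auto simp: antichain_property_def)
  moreover have "card (M c) = 1" for c
    by (simp add: M_def)
  then have "cost ?C M = 1"
    using C by (simp add: cost_def concept_class_def image_constant_conv)
  ultimately show ?thesis
    using AMN_le by metis
qed

lemma not_additiveI:
  assumes "concept_class X1 C1" "concept_class X2 C2" "X1 \<inter> X2 = {}"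
    and "1 \<le> Y X1 C1" "1 \<le> Y X2 C2" "Y (X1 \<union> X2) (free_combination C1 C2) \<le> 1"
  shows "\<not> additive Y"
  using assms unfolding additive_def by fastforce

theorem theorem7p7:
  shows "\<forall>Y \<in> {GMN', SMN, SMN', AMN, AMN'} :: 'a parameter set.
           sub_additive Y \<and> (infinite (UNIV :: 'a set) \<longrightarrow> \<not> additive Y)"
proof -
  have "sub_additive (GMN' :: 'a parameter)" "sub_additive (SMN :: 'a parameter)"
    "sub_additive (SMN' :: 'a parameter)" "sub_additive (AMN :: 'a parameter)"
    "sub_additive (AMN' :: 'a parameter)"
    by (simp_all add: sub_additive_def GMN'_free_combination_le SMN_free_combination_le
        SMN'_free_combination_le AMN_free_combination_le AMN'_free_combination_le)
  moreover have "\<not> additive Y"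
    if inf: "infinite (UNIV :: 'a set)" and Y: "Y \<in> {GMN', SMN, SMN', AMN, AMN'}"
    for Y :: "'a parameter"
  proof -
    \<comment> \<open>For \<open>GMN'\<close> the union of the domains needs three points: \<open>4 \<le> 1 + 3\<close>, but \<open>1 + 2 < 4\<close>.\<close>
    obtain X :: "'a set" where "card X = 3"
      using infinite_arbitrarily_large[OF inf] by blast
    then obtain x y z :: 'a where xyz: "x \<noteq> y" "x \<noteq> z" "y \<noteq> z"
      by (auto simp: card_3_iff)
    define X1 X2 where "X1 = {x}" and "X2 = {y, z}"
    let ?C1 = "const_class X1" and ?C2 = "const_class X2"
    let ?C = "free_combination ?C1 ?C2"
    have X: "finite X1" "finite X2" "X1 \<inter> X2 = {}" "x \<in> X1" "y \<in> X2"
      using xyz by (auto simp: X1_def X2_def)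
    then have C1: "concept_class X1 ?C1" "card ?C1 = 2" and C2: "concept_class X2 ?C2" "card ?C2 = 2"
      by (auto simp: concept_class_const intro: card_const_class)
    have C: "concept_class (X1 \<union> X2) ?C"
      using C1(1) C2(1) by (rule concept_class_free_combination)
    have "card (X1 \<union> X2) = 3"
      using xyz by (simp add: X1_def X2_def)
    then have "GMN' (X1 \<union> X2) ?C \<le> 1"
      using card_free_combination[OF C1(1) C2(1) X(3)] C1(2) C2(2) by (intro GMN'_le) simp
    moreover have "AMN (X1 \<union> X2) ?C \<le> 1"
      using X by (rule AMN_const_free_combination)
    ultimately have upper: "Y (X1 \<union> X2) ?C \<le> 1"
      using Y SMN_le_AMN[OF C] SMN'_le_SMN[OF C] AMN'_le_AMN[OF C] by auto
    \<comment> \<open>Stated for an arbitrary two-element class so that it serves both factors;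
      \<open>SMN'\<close> passes its bound on to the three parameters above it.\<close>
    have lower: "1 \<le> Y X' C'" if C': "concept_class X' C'" "card C' = 2" for X' C'
    proof -
      have "1 \<le> GMN' X' C'" "1 \<le> SMN' X' C'"
        using C' by (auto intro!: one_le_GMN' one_le_SMN' simp del: One_nat_def)
      then show ?thesis
        using Y SMN_le_AMN[OF C'(1)] SMN'_le_SMN[OF C'(1)] SMN'_le_AMN'[OF C'(1)] by auto
    qed
    show ?thesis
      using C1(1) C2(1) X(3) lower[OF C1] lower[OF C2] upper by (rule not_additiveI)
  qed
  ultimately show ?thesis by auto
qed

end
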